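(* Let $\varphi$ be an injective self-map of $T$ which has no periodic points, such that $C_\varphi$ is bounded on $\mathcal{L}_0$, and let $\lambda\in\mathbb{C}$ with $|\lambda|\le 1$. For each $v\in T$ and each $n\in\mathbb{N}$ define $$m(n,v):=\min\{d(\varphi^n(u),\varphi^n(v)) : u\in T,\ u\ne v\}.$$ Assume that (1) for all $v\in T$, $|\lambda|^n m(n,v)\to\infty$ as $n\to\infty$; and (2) there exist $c\in\mathbb{N}$ and $N\in\mathbb{N}$ such that for all $n\ge N$ and all $v\in T$, $|\varphi^n(v)|+c\ge m(n,v)$. Furthermore, if $|\lambda|=1$, assume that for each $v\in T$ the set $\{n\in\mathbb{N}:\varphi^{-n}(\{v\})\ne\varnothing\}$ is finite. Then $\lambda C_\varphi$ is mixing on $\mathcal{L}_0$.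
   Context: $T$ is an infinite, locally finite tree (connected graph without cycles, identified with its vertex set) with a chosen root $o$, in which every vertex except possibly $o$ has degree greater than $1$. $d(v,w)$ is the number of edges of the unique path joining $v$ and $w$, and $|v|=d(o,v)$. $T^*=T\setminus\{o\}$. For $v\in T^*$, the parent $v^-$ is the neighbor of $v$ on the path from $o$ to $v$. The Lipschitz space $\mathcal{L}$ is the set of $f:T\to\mathbb{C}$ with $\sup_{v\in T^*}|f(v)-f(v^-)|<\infty$, a Banach space under $\|f\|_{\mathcal{L}}=\max\{|f(o)|,\sup_{v\in T^*}|f(v)-f(v^-)|\}$. The little Lipschitz space $\mathcal{L}_0$ is the closed subspace of $f\in\mathcal{L}$ with $\lim_{|v|\to\infty}|f(v)-f(v^-)|=0$. The composition operator is $C_\varphi f=f\circ\varphi$; it is bounded on $\mathcal{L}_0$ if it maps $\mathcal{L}_0$ into itself and is a bounded operator there. $\varphi^n$ is the $n$-fold iterate of $\varphi$, $\varphi^{-n}(\{v\})=\{u\in T:\varphi^n(u)=v\}$, and a periodic point of $\varphi$ is a vertex $v$ with $\varphi^p(v)=v$ for some integer $p\ge1$. $\mathbb{N}=\{1,2,3,\dots\}$. A bounded operator $A$ on a Banach space $\mathcal{B}$ is mixing if for all nonempty open $U,V\subseteq\mathcal{B}$ there is $N_0$ such that $A^n(U)\cap V\ne\varnothing$ for all $n\ge N_0$. *)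

theory Defs
  imports "HOL-Analysis.Analysis"
begin

text \<open>A graph is given by an adjacency relation on a type, the whole type being the vertex set.
  Paths and cycles are lists of vertices.  Cycles are required to have at least three vertices, so
  that traversing an edge back and forth is not a cycle.\<close>

definition is_path :: "('v \<Rightarrow> 'v \<Rightarrow> bool) \<Rightarrow> 'v \<Rightarrow> 'v list \<Rightarrow> 'v \<Rightarrow> bool" where
  "is_path E u p v \<longleftrightarrow> p \<noteq> [] \<and> successively E p \<and> distinct p \<and> hd p = u \<and> last p = v"

definition is_cycle :: "('v \<Rightarrow> 'v \<Rightarrow> bool) \<Rightarrow> 'v list \<Rightarrow> bool" where
  "is_cycle E p \<longleftrightarrow> length p \<ge> 3 \<and> successively E p \<and> distinct p \<and> E (last p) (hd p)"

definition is_tree :: "('v \<Rightarrow> 'v \<Rightarrow> bool) \<Rightarrow> bool" where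
  "is_tree E \<longleftrightarrow> symp E \<and> irreflp E \<and> (\<forall>u v. \<exists>p. is_path E u p v) \<and> (\<nexists>p. is_cycle E p)"

locale rooted_tree =
  fixes E :: "'v \<Rightarrow> 'v \<Rightarrow> bool" and r :: 'v
  assumes tree: "is_tree E"
    and infinite_vertices: "infinite (UNIV :: 'v set)"
    and locally_finite: "\<And>v. finite {w. E v w}"
    and degree_gt_1: "\<And>v. v \<noteq> r \<Longrightarrow> card {w. E v w} > 1"

definition the_path :: "('v \<Rightarrow> 'v \<Rightarrow> bool) \<Rightarrow> 'v \<Rightarrow> 'v \<Rightarrow> 'v list" where
  "the_path E u v = (THE p. is_path E u p v)"

definition tree_dist :: "('v \<Rightarrow> 'v \<Rightarrow> bool) \<Rightarrow> 'v \<Rightarrow> 'v \<Rightarrow> nat" where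
  "tree_dist E u v = length (the_path E u v) - 1"

text \<open>Only meaningful for \<open>v \<noteq> r\<close>.\<close>

definition parent :: "('v \<Rightarrow> 'v \<Rightarrow> bool) \<Rightarrow> 'v \<Rightarrow> 'v \<Rightarrow> 'v" where
  "parent E r v = (THE w. E v w \<and> w \<in> set (the_path E r v))"

definition lip_space :: "('v \<Rightarrow> 'v \<Rightarrow> bool) \<Rightarrow> 'v \<Rightarrow> ('v \<Rightarrow> complex) set" where
  "lip_space E r = {f. bdd_above ((\<lambda>v. cmod (f v - f (parent E r v))) ` (- {r}))}"

definition lip_norm :: "('v \<Rightarrow> 'v \<Rightarrow> bool) \<Rightarrow> 'v \<Rightarrow> ('v \<Rightarrow> complex) \<Rightarrow> real" where
  "lip_norm E r f = max (cmod (f r)) (SUP v\<in>- {r}. cmod (f v - f (parent E r v)))"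

text \<open>The filter expresses \<open>|v| \<rightarrow> \<infinity>\<close>; the junk value of \<open>parent\<close> at the root does not affect it.\<close>

definition little_lip_space :: "('v \<Rightarrow> 'v \<Rightarrow> bool) \<Rightarrow> 'v \<Rightarrow> ('v \<Rightarrow> complex) set" where
  "little_lip_space E r =
     {f \<in> lip_space E r.
        ((\<lambda>v. cmod (f v - f (parent E r v))) \<longlongrightarrow> 0) (filtercomap (tree_dist E r) at_top)}"

definition comp_op :: "('v \<Rightarrow> 'v) \<Rightarrow> ('v \<Rightarrow> complex) \<Rightarrow> 'v \<Rightarrow> complex" where
  "comp_op \<phi> f = f \<circ> \<phi>"

text \<open>The spaces depend on the tree, so they are handled as sets \<open>S\<close> of functions together with a
  norm \<open>nrm\<close>, rather than as types.\<close>

definition bounded_operator_on ::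
    "('v \<Rightarrow> complex) set \<Rightarrow> (('v \<Rightarrow> complex) \<Rightarrow> real) \<Rightarrow> (('v \<Rightarrow> complex) \<Rightarrow> 'v \<Rightarrow> complex) \<Rightarrow> bool" where
  "bounded_operator_on S nrm A \<longleftrightarrow>
     (\<forall>f\<in>S. A f \<in> S) \<and>
     (\<forall>f\<in>S. \<forall>g\<in>S. A (\<lambda>v. f v + g v) = (\<lambda>v. A f v + A g v)) \<and>
     (\<forall>a. \<forall>f\<in>S. A (\<lambda>v. a * f v) = (\<lambda>v. a * A f v)) \<and>
     (\<exists>K. \<forall>f\<in>S. nrm (A f) \<le> K * nrm f)"

definition norm_topology ::
    "('v \<Rightarrow> complex) set \<Rightarrow> (('v \<Rightarrow> complex) \<Rightarrow> real) \<Rightarrow> ('v \<Rightarrow> complex) topology" where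
  "norm_topology S nrm = Metric_space.mtopology S (\<lambda>f g. nrm (\<lambda>v. f v - g v))"

definition mixing_on ::
    "('v \<Rightarrow> complex) set \<Rightarrow> (('v \<Rightarrow> complex) \<Rightarrow> real) \<Rightarrow> (('v \<Rightarrow> complex) \<Rightarrow> 'v \<Rightarrow> complex) \<Rightarrow> bool" where
  "mixing_on S nrm A \<longleftrightarrow>
     bounded_operator_on S nrm A \<and>
     (\<forall>U V. openin (norm_topology S nrm) U \<and> U \<noteq> {} \<and> openin (norm_topology S nrm) V \<and> V \<noteq> {} \<longrightarrow>
        (\<exists>N\<^sub>0. \<forall>n\<ge>N\<^sub>0. (A ^^ n) ` U \<inter> V \<noteq> {}))"

definition periodic_point :: "('v \<Rightarrow> 'v) \<Rightarrow> 'v \<Rightarrow> bool" where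
  "periodic_point \<phi> v \<longleftrightarrow> (\<exists>p\<ge>1. (\<phi> ^^ p) v = v)"

definition min_dist :: "('v \<Rightarrow> 'v \<Rightarrow> bool) \<Rightarrow> ('v \<Rightarrow> 'v) \<Rightarrow> nat \<Rightarrow> 'v \<Rightarrow> nat" where
  "min_dist E \<phi> n v = (LEAST k. \<exists>u. u \<noteq> v \<and> k = tree_dist E ((\<phi> ^^ n) u) ((\<phi> ^^ n) v))"

end

theory Submission
  imports Defs
begin

text \<open>Kitai's criterion is applied with the finitely supported functions as dense set.  Density
  comes from the cutoffs \<open>max 0 (1 - |v| / M)\<close>, because a function in the little Lipschitz space
  grows like \<open>o(|v|)\<close>.  On a finitely supported \<open>f\<close> the powers of \<open>\<lambda>C\<^sub>\<phi>\<close>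
  tend to zero: \<open>|\<lambda>|\<^sup>n\<close> does if \<open>|\<lambda>| < 1\<close>, and otherwise \<open>\<phi>\<^sup>n\<close> eventually avoids the support of \<open>f\<close>.
  A preimage under the \<open>n\<close>-th power of the indicator function of \<open>w\<close> is the tent
  \<open>x \<mapsto> \<lambda>\<^sup>-\<^sup>n max 0 (1 - d(x, \<phi>\<^sup>n w) / m(n, w))\<close>: it has slope
  \<open>1 / (|\<lambda>|\<^sup>n m(n, w))\<close>, which tends to zero by (1), and (2) bounds its value at the
  root by \<open>c\<close> times the slope.\<close>

section \<open>Paths in trees\<close>

text \<open>Loop erasure, built from the far end: if the new first vertex already lies on the path
  obtained for the tail, the part before it is cut off, otherwise it is prepended. The inclusion of
  vertex sets later keeps a prescribed vertex off the path.\<close>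

lemma walk_imp_path:
  assumes "successively E p" "p \<noteq> []"
  obtains q where "is_path E (hd p) q (last p)" "set q \<subseteq> set p"
proof -
  have "\<exists>q. is_path E (hd p) q (last p) \<and> set q \<subseteq> set p"
    using assms
  proof (induction p)
    case (Cons x xs)
    show ?case
    proof (cases "xs = []")
      case True
      then show ?thesis by (intro exI[of _ "[x]"]) (auto simp: is_path_def)
    next
      case False
      with Cons obtain q where q: "is_path E (hd xs) q (last xs)" "set q \<subseteq> set xs"
        by (auto simp: successively_Cons)
      show ?thesis
      proof (cases "x \<in> set q")
        case True
        then obtain ys zs where "q = ys @ x # zs" by (auto simp: in_set_conv_decomp)
        with q False show ?thesis
          by (intro exI[of _ "x # zs"]) (auto simp: is_path_def successively_append_iff)
      next
        case nx: False
        with q False Cons.prems show ?thesis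
          by (intro exI[of _ "x # q"]) (auto simp: is_path_def successively_Cons)
      qed
    qed
  qed simp
  then show thesis using that by blast
qed

context rooted_tree
begin

lemma sym: "E u v \<Longrightarrow> E v u"
  using tree by (auto simp: is_tree_def dest: sympD)

lemma irrefl: "\<not> E u u"
  using tree by (auto simp: is_tree_def irreflp_def)

lemma acyclic: "\<not> is_cycle E p"
  using tree by (auto simp: is_tree_def)

lemma is_path_rev: "is_path E u p v \<Longrightarrow> is_path E v (rev p) u"
  by (auto simp: is_path_def hd_rev last_rev sym elim!: successively_mono)

text \<open>If two paths from \<open>x\<close> to \<open>v\<close> had different second vertices,
  following one to \<open>v\<close> and the other back would join these vertices by a walk avoiding
  \<open>x\<close>; its loop erasure together with \<open>x\<close> would be a cycle. So the second
  vertices agree, and induction handles the tails.\<close>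

lemma is_path_unique:
  assumes "is_path E u p v" "is_path E u q v"
  shows "p = q"
  using assms
proof (induction p arbitrary: u q)
  case Nil
  then show ?case by (simp add: is_path_def)
next
  case (Cons x p)
  obtain q' where q: "q = x # q'"
    using Cons.prems by (cases q) (auto simp: is_path_def)
  show ?case
  proof (cases "p = [] \<or> q' = []")
    case True
    then show ?thesis using Cons.prems q
      by (auto simp: is_path_def split: if_splits)
  next
    case False
    then have p': "is_path E (hd p) p v" and q': "is_path E (hd q') q' v"
      and x: "x \<notin> set p" "x \<notin> set q'" "E x (hd p)" "E x (hd q')"
      using Cons.prems q by (auto simp: is_path_def successively_Cons)
    have "hd p = hd q'"
    proof (rule ccontr)
      assume neq: "hd p \<noteq> hd q'"
      \<comment> \<open>\<open>p\<close> ends and \<open>rev q'\<close> begins with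
        \<open>v\<close>. Taking the tail removes the repetition, which would demand the impossible
        edge from \<open>v\<close> to itself.\<close>
      have "successively E (p @ tl (rev q'))"
      proof -
        obtain ys where ys: "rev q' = v # ys"
          using is_path_rev[OF q'] by (cases "rev q'") (auto simp: is_path_def)
        then show ?thesis
          using p' is_path_rev[OF q']
          by (auto simp: is_path_def successively_append_iff successively_Cons)
      qed
      then obtain s where "is_path E (hd (p @ tl (rev q'))) s (last (p @ tl (rev q')))"
        "set s \<subseteq> set (p @ tl (rev q'))"
        using False by (elim walk_imp_path) simp
      moreover have "set (tl (rev q')) \<subseteq> set q'"
        by (metis list.sel(2) list.set_sel(2) set_rev subsetI)
      ultimately have s: "is_path E (hd p) s (last (p @ tl (rev q')))"
        and sub: "set s \<subseteq> set p \<union> set q'"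
        using False by auto
      have "last (p @ tl (rev q')) = hd q'"
      proof (cases "tl (rev q') = []")
        case True
        then have "q' = [v]"
          using q' by (cases "rev q'") (auto simp: is_path_def)
        then show ?thesis using p' by (auto simp: is_path_def)
      next
        case t: False
        then show ?thesis by (simp add: last_tl last_rev)
      qed
      with s have s: "is_path E (hd p) s (hd q')" by simp
      \<comment> \<open>With \<open>x\<close> in front this gives the three vertices that
        \<open>is_cycle\<close> demands.\<close>
      have "length s \<ge> 2"
        using s neq by (cases s; cases "tl s") (auto simp: is_path_def)
      then have "is_cycle E (x # s)"
        using s sub x sym by (auto simp: is_cycle_def is_path_def successively_Cons)
      then show False using acyclic by blast
    qed
    then show ?thesis using Cons.IH[OF p', of q'] q' q by simp
  qed
qed

section \<open>Tree distance, finiteness of balls, and parents\<close>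

lemma is_path_the_path: "is_path E u (the_path E u v) v"
proof -
  obtain p where "is_path E u p v" using tree unfolding is_tree_def by blast
  then show ?thesis unfolding the_path_def
    by (rule theI) (blast intro: is_path_unique \<open>is_path E u p v\<close>)
qed

lemma the_path_eq: "is_path E u p v \<Longrightarrow> the_path E u v = p"
  using is_path_the_path is_path_unique by blast

lemma tree_dist_eq: "is_path E u p v \<Longrightarrow> tree_dist E u v = length p - 1"
  by (simp add: tree_dist_def the_path_eq)

lemma tree_dist_commute: "tree_dist E u v = tree_dist E v u"
  using tree_dist_eq[OF is_path_rev[OF is_path_the_path[of u v]]] by (simp add: tree_dist_def)

lemma tree_dist_self [simp]: "tree_dist E u u = 0"
  using tree_dist_eq[of u "[u]" u] by (simp add: is_path_def)

lemma tree_dist_eq_0_iff [simp]: "tree_dist E u v = 0 \<longleftrightarrow> u = v"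
proof
  assume "tree_dist E u v = 0"
  then have "length (the_path E u v) \<le> 1" by (simp add: tree_dist_def)
  then show "u = v" using is_path_the_path[of u v]
    by (cases "the_path E u v") (auto simp: is_path_def)
qed simp

text \<open>The path from \<open>x\<close> to \<open>z\<close> is a final segment of the one from
  \<open>y\<close> if \<open>x\<close> lies on it, and otherwise extends it by one edge. Applied in
  both directions, this makes the distance to \<open>z\<close> change by at most 1 along an
  edge.\<close>

lemma tree_dist_adj:
  assumes "E x y"
  shows "tree_dist E x z \<le> tree_dist E y z + 1"
proof -
  define p where "p = the_path E y z"
  have p: "is_path E y p z" unfolding p_def by (rule is_path_the_path)
  show ?thesis
  proof (cases "x \<in> set p")
    case True
    then obtain ys zs where "p = ys @ x # zs" by (auto simp: in_set_conv_decomp)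
    moreover from this p have "is_path E x (x # zs) z"
      by (auto simp: is_path_def successively_append_iff)
    ultimately show ?thesis using p by (simp add: tree_dist_eq)
  next
    case False
    with p assms have "is_path E x (x # p) z" by (auto simp: is_path_def successively_Cons)
    then show ?thesis using p by (simp add: tree_dist_eq)
  qed
qed

lemma tree_dist_SucE:
  assumes "tree_dist E x z = Suc n"
  obtains y where "E y x" "tree_dist E y z = n"
proof -
  define p where "p = the_path E x z"
  have p: "is_path E x p z" unfolding p_def by (rule is_path_the_path)
  with assms obtain y ys where eq: "p = x # y # ys"
    by (cases p; cases "tl p") (auto simp: tree_dist_eq is_path_def)
  with p have "is_path E y (y # ys) z" "E y x" by (auto simp: is_path_def sym)
  with p assms eq show thesis by (intro that[of y]) (auto simp: tree_dist_eq)
qed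

text \<open>Every vertex of the sphere of radius \<open>Suc n\<close> is adjacent to a vertex of the
  ball of radius \<open>n\<close>, so local finiteness carries the induction.\<close>

lemma finite_ball: "finite {x. tree_dist E x z \<le> n}"
proof (induction n)
  case (Suc n)
  have "{x. tree_dist E x z \<le> Suc n}
      \<subseteq> {x. tree_dist E x z \<le> n} \<union> (\<Union>y\<in>{x. tree_dist E x z \<le> n}. {x. E y x})"
    by (auto simp: le_Suc_eq elim!: tree_dist_SucE)
  then show ?case
    by (rule finite_subset) (use Suc locally_finite in auto)
qed simp

lemma finite_depth: "finite {v. tree_dist E r v \<le> n}"
  using finite_ball[of r n] by (simp add: tree_dist_commute)

lemma parent_adj_depth:
  assumes "v \<noteq> r"
  shows "E (parent E r v) v" and "tree_dist E r v = Suc (tree_dist E r (parent E r v))"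
proof -
  define p where "p = the_path E r v"
  have p: "is_path E r p v" unfolding p_def by (rule is_path_the_path)
  obtain p' where "p = p' @ [v]"
    using p by (cases p rule: rev_cases) (auto simp: is_path_def)
  with p assms have p': "p = p' @ [v]" "p' \<noteq> []" by (auto simp: is_path_def)
  \<comment> \<open>The vertex before \<open>v\<close> on the path from the root is the
    parent.\<close>
  define w where "w = last p'"
  have w: "E w v" "w \<in> set p" and rw: "is_path E r p' w"
    using p p' by (auto simp: w_def is_path_def successively_append_iff)
  have "parent E r v = w"
    unfolding parent_def p_def[symmetric]
  proof (rule the_equality)
    fix u assume u: "E v u \<and> u \<in> set p"
    then have "u \<in> set p'" using p' irrefl by auto
    then obtain ys zs where ys: "p' = ys @ u # zs" by (auto simp: in_set_conv_decomp)
    \<comment> \<open>The end of the root path from \<open>u\<close> on and the single edge from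
      \<open>u\<close> to \<open>v\<close> are both paths, so they coincide and nothing lies between
      \<open>u\<close> and \<open>v\<close>.\<close>
    have "is_path E u (u # zs @ [v]) v"
      using p p' ys by (auto simp: is_path_def successively_append_iff)
    moreover have "is_path E u [u, v] v" using u sym irrefl by (auto simp: is_path_def)
    ultimately have "u # zs @ [v] = [u, v]" by (rule is_path_unique)
    then show "u = w" using ys by (simp add: w_def)
  qed (use w sym in auto)
  then show "E (parent E r v) v" "tree_dist E r v = Suc (tree_dist E r (parent E r v))"
    using w p p' rw by (simp_all add: tree_dist_eq)
qed

section \<open>The little Lipschitz space\<close>

text \<open>The limit yields the bound defining \<open>lip_space\<close>: the differences are below
  1 from some depth on, and only finitely many vertices remain.\<close>

lemma little_lip_space_iff:
  "f \<in> little_lip_space E r \<longleftrightarrow>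
    (\<forall>e>0. \<exists>N. \<forall>v. N \<le> tree_dist E r v \<longrightarrow> cmod (f v - f (parent E r v)) < e)"
proof -
  have "f \<in> lip_space E r"
    if lim: "\<forall>e>0. \<exists>N. \<forall>v. N \<le> tree_dist E r v \<longrightarrow> cmod (f v - f (parent E r v)) < e"
  proof -
    let ?D = "\<lambda>v. cmod (f v - f (parent E r v))"
    from lim obtain N where N: "\<And>v. N \<le> tree_dist E r v \<Longrightarrow> ?D v < 1"
      by (meson zero_less_one)
    have "?D ` (- {r}) \<subseteq> ?D ` {v. tree_dist E r v \<le> N} \<union> {..1}"
    proof (intro image_subsetI)
      show "?D v \<in> ?D ` {v. tree_dist E r v \<le> N} \<union> {..1}" for v
        using N[of v] by (cases "tree_dist E r v \<le> N") auto
    qed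
    moreover have "bdd_above (?D ` {v. tree_dist E r v \<le> N} \<union> {..1})"
      by (simp add: finite_depth)
    ultimately show ?thesis unfolding lip_space_def mem_Collect_eq
      by (rule bdd_above_mono[rotated])
  qed
  moreover have "((\<lambda>v. cmod (f v - f (parent E r v))) \<longlongrightarrow> 0) (filtercomap (tree_dist E r) at_top) \<longleftrightarrow>
      (\<forall>e>0. \<exists>N. \<forall>v. N \<le> tree_dist E r v \<longrightarrow> cmod (f v - f (parent E r v)) < e)"
    by (simp add: tendsto_iff eventually_filtercomap_at_top_linorder)
  ultimately show ?thesis by (auto simp: little_lip_space_def)
qed

lemma little_lip_space_add:
  assumes "f \<in> little_lip_space E r" "g \<in> little_lip_space E r"
  shows "(\<lambda>v. f v + g v) \<in> little_lip_space E r"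
  unfolding little_lip_space_iff
proof (intro allI impI)
  fix e :: real assume "e > 0"
  then obtain M N where M: "\<And>v. M \<le> tree_dist E r v \<Longrightarrow> cmod (f v - f (parent E r v)) < e / 2"
    and N: "\<And>v. N \<le> tree_dist E r v \<Longrightarrow> cmod (g v - g (parent E r v)) < e / 2"
    using assms unfolding little_lip_space_iff by (meson half_gt_zero)
  have "cmod (f v + g v - (f (parent E r v) + g (parent E r v))) < e"
    if "max M N \<le> tree_dist E r v" for v
  proof -
    have "cmod (f v + g v - (f (parent E r v) + g (parent E r v)))
        \<le> cmod (f v - f (parent E r v)) + cmod (g v - g (parent E r v))"
      by (rule norm_diff_triangle_ineq)
    with M[of v] N[of v] that show ?thesis by simp
  qed
  then show "\<exists>N. \<forall>v. N \<le> tree_dist E r v \<longrightarrow>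
      cmod (f v + g v - (f (parent E r v) + g (parent E r v))) < e" by blast
qed

lemma little_lip_space_cmult:
  assumes "f \<in> little_lip_space E r"
  shows "(\<lambda>v. a * f v) \<in> little_lip_space E r"
  unfolding little_lip_space_iff
proof (intro allI impI)
  fix e :: real assume "e > 0"
  \<comment> \<open>The added 1 covers \<open>a = 0\<close>.\<close>
  then have "e / (cmod a + 1) > 0" by (simp add: add_nonneg_pos)
  then obtain N where
    N: "\<And>v. N \<le> tree_dist E r v \<Longrightarrow> cmod (f v - f (parent E r v)) < e / (cmod a + 1)"
    using assms unfolding little_lip_space_iff by meson
  have "cmod (a * f v - a * f (parent E r v)) < e" if "N \<le> tree_dist E r v" for v
  proof -
    have "cmod (a * f v - a * f (parent E r v)) = cmod a * cmod (f v - f (parent E r v))"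
      by (metis norm_mult right_diff_distrib)
    also have "\<dots> \<le> (cmod a + 1) * cmod (f v - f (parent E r v))"
      by (simp add: mult_right_mono)
    also have "\<dots> < e"
      using N[OF that] by (simp add: pos_less_divide_eq add_nonneg_pos mult.commute)
    finally show ?thesis .
  qed
  then show "\<exists>N. \<forall>v. N \<le> tree_dist E r v \<longrightarrow> cmod (a * f v - a * f (parent E r v)) < e" by blast
qed

lemma little_lip_space_diff:
  assumes "f \<in> little_lip_space E r" "g \<in> little_lip_space E r"
  shows "(\<lambda>v. f v - g v) \<in> little_lip_space E r"
  using little_lip_space_add[OF assms(1) little_lip_space_cmult[OF assms(2), of "-1"]] by simp

lemma finite_support_little_lip:
  assumes "finite {v. f v \<noteq> 0}"
  shows "f \<in> little_lip_space E r"
proof -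
  obtain N where N: "\<And>v. f v \<noteq> 0 \<Longrightarrow> tree_dist E r v \<le> N"
    using finite_nat_set_iff_bounded_le[of "tree_dist E r ` {v. f v \<noteq> 0}"] assms by auto
  \<comment> \<open>The margin 2 leaves the parent, one level higher, still deeper than
    \<open>N\<close>.\<close>
  have "f v = 0 \<and> f (parent E r v) = 0" if "N + 2 \<le> tree_dist E r v" for v
  proof -
    from that have "v \<noteq> r" by auto
    from parent_adj_depth(2)[OF this] N that show ?thesis by fastforce
  qed
  then show ?thesis unfolding little_lip_space_iff by (metis diff_zero norm_zero)
qed

section \<open>The Lipschitz norm, its metric, and density of finite support\<close>

lemma ex_non_root: "- {r} \<noteq> {}"
  using infinite_vertices by (metis finite.simps finite_Diff2 Compl_eq_Diff_UNIV)

lemma lip_norm_leI: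
  assumes "cmod (f r) \<le> B" "\<And>v. v \<noteq> r \<Longrightarrow> cmod (f v - f (parent E r v)) \<le> B"
  shows "lip_norm E r f \<le> B"
  \<comment> \<open>\<open>cSUP_least\<close> needs a nonempty index set.\<close>
  unfolding lip_norm_def using assms ex_non_root by (auto intro!: cSUP_least)

lemma norm_root_le_lip_norm: "cmod (f r) \<le> lip_norm E r f"
  by (simp add: lip_norm_def)

lemma lip_norm_nonneg: "0 \<le> lip_norm E r f"
  by (meson norm_root_le_lip_norm norm_ge_zero order_trans)

lemma norm_diff_parent_le_lip_norm:
  assumes "f \<in> little_lip_space E r" "v \<noteq> r"
  shows "cmod (f v - f (parent E r v)) \<le> lip_norm E r f"
  unfolding lip_norm_def using assms
  by (intro max.coboundedI2 cSUP_upper) (auto simp: little_lip_space_def lip_space_def)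

lemma lip_norm_cmult_le:
  assumes "f \<in> little_lip_space E r"
  shows "lip_norm E r (\<lambda>v. a * f v) \<le> cmod a * lip_norm E r f"
proof (rule lip_norm_leI)
  show "cmod (a * f r) \<le> cmod a * lip_norm E r f"
    by (simp add: norm_mult norm_root_le_lip_norm mult_left_mono)
next
  fix v assume "v \<noteq> r"
  have "cmod (a * f v - a * f (parent E r v)) = cmod a * cmod (f v - f (parent E r v))"
    by (metis norm_mult right_diff_distrib)
  also have "\<dots> \<le> cmod a * lip_norm E r f"
    by (intro mult_left_mono norm_diff_parent_le_lip_norm assms \<open>v \<noteq> r\<close> norm_ge_zero)
  finally show "cmod (a * f v - a * f (parent E r v)) \<le> cmod a * lip_norm E r f" .
qed

lemma lip_norm_triangle:
  assumes "f \<in> little_lip_space E r" "g \<in> little_lip_space E r"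
  shows "lip_norm E r (\<lambda>v. f v + g v) \<le> lip_norm E r f + lip_norm E r g"
proof (rule lip_norm_leI)
  show "cmod (f r + g r) \<le> lip_norm E r f + lip_norm E r g"
    by (meson add_mono norm_root_le_lip_norm norm_triangle_ineq order_trans)
next
  fix v assume "v \<noteq> r"
  have "cmod (f v + g v - (f (parent E r v) + g (parent E r v)))
      \<le> cmod (f v - f (parent E r v)) + cmod (g v - g (parent E r v))"
    by (rule norm_diff_triangle_ineq)
  also have "\<dots> \<le> lip_norm E r f + lip_norm E r g"
    by (intro add_mono norm_diff_parent_le_lip_norm assms \<open>v \<noteq> r\<close>)
  finally show "cmod (f v + g v - (f (parent E r v) + g (parent E r v)))
      \<le> lip_norm E r f + lip_norm E r g" .
qed

text \<open>This is the growth \<open>o(|v|)\<close>: below depth \<open>N\<close> each further edge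
  adds at most \<open>e\<close>, and \<open>C\<close> bounds \<open>f\<close> on the finite ball of
  radius \<open>N\<close>.\<close>

lemma norm_le_depth:
  fixes e :: real
  assumes "f \<in> little_lip_space E r" "e > 0"
  obtains C where "\<And>v. cmod (f v) \<le> C + e * tree_dist E r v"
proof -
  obtain N where N: "\<And>v. N \<le> tree_dist E r v \<Longrightarrow> cmod (f v - f (parent E r v)) < e"
    using assms unfolding little_lip_space_iff by meson
  obtain C where C: "\<And>v. tree_dist E r v \<le> N \<Longrightarrow> cmod (f v) \<le> C"
    using bdd_above_finite[OF finite_imageI[OF finite_depth], of "\<lambda>v. cmod (f v)" N]
    by (auto simp: bdd_above_def)
  have "cmod (f v) \<le> C + e * n" if "tree_dist E r v = n" for v n
    using that
  proof (induction n arbitrary: v)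
    case 0
    then show ?case using C[of v] by simp
  next
    case (Suc n)
    then have "v \<noteq> r" by auto
    with Suc have IH: "cmod (f (parent E r v)) \<le> C + e * n"
      using parent_adj_depth(2)[of v] by simp
    show ?case
    proof (cases "tree_dist E r v \<le> N")
      case True
      then show ?thesis using C[of v] \<open>e > 0\<close> by (simp add: add_increasing2)
    next
      case False
      then have "cmod (f v - f (parent E r v)) < e" by (intro N) simp
      moreover have "cmod (f v) \<le> cmod (f (parent E r v)) + cmod (f v - f (parent E r v))"
        by (rule norm_triangle_sub)
      ultimately show ?thesis using IH by (simp add: algebra_simps)
    qed
  qed
  then show thesis using that by blast
qed

text \<open>A zero norm makes \<open>f\<close> vanish at the root and constant along every edge; the
  zero spreads by induction on depth.\<close>

lemma lip_norm_eq_0_iff: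
  assumes "f \<in> little_lip_space E r"
  shows "lip_norm E r f = 0 \<longleftrightarrow> f = (\<lambda>_. 0)"
proof
  assume 0: "lip_norm E r f = 0"
  have "f v = 0" if "tree_dist E r v = n" for v n
    using that
  proof (induction n arbitrary: v)
    case 0
    then show ?case using norm_root_le_lip_norm[of f] \<open>lip_norm E r f = 0\<close> by simp
  next
    case (Suc n)
    then have "v \<noteq> r" by auto
    with Suc norm_diff_parent_le_lip_norm[OF assms this] 0 parent_adj_depth(2)[of v]
    show ?case by simp
  qed
  then show "f = (\<lambda>_. 0)" by blast
next
  assume "f = (\<lambda>_. 0)"
  then show "lip_norm E r f = 0"
    using lip_norm_leI[of f 0] lip_norm_nonneg[of f] by auto
qed

lemma Metric_space_little_lip:
  "Metric_space (little_lip_space E r) (\<lambda>f g. lip_norm E r (\<lambda>v. f v - g v))"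
proof
  fix f g :: "'v \<Rightarrow> complex"
  show "0 \<le> lip_norm E r (\<lambda>v. f v - g v)" by (rule lip_norm_nonneg)
  show "lip_norm E r (\<lambda>v. f v - g v) = lip_norm E r (\<lambda>v. g v - f v)"
  proof -
    have "cmod ((f v - g v) - (f w - g w)) = cmod ((g v - f v) - (g w - f w))" for v w
      using norm_minus_cancel[of "(f v - g v) - (f w - g w)"] by (simp add: algebra_simps)
    then show ?thesis unfolding lip_norm_def by (simp add: norm_minus_commute)
  qed
next
  fix f g assume "f \<in> little_lip_space E r" "g \<in> little_lip_space E r"
  then show "lip_norm E r (\<lambda>v. f v - g v) = 0 \<longleftrightarrow> f = g"
    by (simp add: lip_norm_eq_0_iff[OF little_lip_space_diff] fun_eq_iff)
next
  fix f g h assume "f \<in> little_lip_space E r" "g \<in> little_lip_space E r" "h \<in> little_lip_space E r"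
  then show "lip_norm E r (\<lambda>v. f v - h v) \<le> lip_norm E r (\<lambda>v. f v - g v) + lip_norm E r (\<lambda>v. g v - h v)"
    using lip_norm_triangle[of "\<lambda>v. f v - g v" "\<lambda>v. g v - h v"] by (simp add: little_lip_space_diff)
qed

text \<open>The error is \<open>f\<close> times the ramp \<open>t\<close>, which rises with slope
  \<open>1 / M\<close> from 0 at the root to 1 at depth \<open>M\<close>. A product rule splits its
  difference along an edge into the difference of \<open>f\<close> weighted by \<open>t\<close> and
  the size of \<open>f\<close> weighted by the slope.\<close>

lemma finite_support_dense:
  assumes f: "f \<in> little_lip_space E r" and "e > 0"
  obtains g where "finite {v. g v \<noteq> 0}" "lip_norm E r (\<lambda>v. f v - g v) < e"
proof -
  \<comment> \<open>The two terms of the product rule cost \<open>d\<close> and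
    \<open>2 * d\<close>; the fourth quarter makes the inequality strict.\<close>
  define d where "d = e / 4"
  have d: "d > 0" using \<open>e > 0\<close> by (simp add: d_def)
  obtain C where C: "\<And>v. cmod (f v) \<le> C + d * tree_dist E r v"
    using norm_le_depth[OF f d] by blast
  have "C \<ge> 0" using C[of r] order_trans[OF norm_ge_zero] by auto
  obtain N where N: "\<And>v. N \<le> tree_dist E r v \<Longrightarrow> cmod (f v - f (parent E r v)) < d"
    using f d unfolding little_lip_space_iff by meson
  define L where "L = lip_norm E r f"
  have L: "L \<ge> 0" by (simp add: L_def lip_norm_nonneg)
  have nonneg: "L * N \<ge> 0" "(L * N + C) / d \<ge> 0" using L \<open>C \<ge> 0\<close> d by simp_all
  \<comment> \<open>\<open>M\<close> absorbs both the differences of \<open>f\<close> above depth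
    \<open>N\<close>, at most \<open>L\<close> each, and the constant \<open>C\<close> of the growth
    bound.\<close>
  obtain M :: nat where "(L * N + C) / d < M" using reals_Archimedean2 by blast
  with nonneg have "M > 0" "L * N + C < M * d"
    using d by (metis of_nat_0_less_iff order_le_less_trans, simp add: pos_divide_less_eq)
  with nonneg \<open>C \<ge> 0\<close> have M: "M > 0" "L * N \<le> d * M" "C \<le> d * M"
    by (simp_all add: mult.commute)
  define t where "t v = min 1 (tree_dist E r v / M)" for v
  define g where "g v = f v * (1 - of_real (t v))" for v
  have t: "0 \<le> t v" "t v \<le> 1" for v by (auto simp: t_def)
  have fg: "(\<lambda>v. f v - g v) = (\<lambda>v. f v * of_real (t v))"
    by (auto simp: g_def algebra_simps)
  have "lip_norm E r (\<lambda>v. f v - g v) \<le> 3 * d"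
    unfolding fg
  proof (rule lip_norm_leI)
    show "cmod (f r * of_real (t r)) \<le> 3 * d" using d by (simp add: t_def)
  next
    fix v assume "v \<noteq> r"
    define w where "w = parent E r v"
    have dv: "tree_dist E r v = Suc (tree_dist E r w)"
      using parent_adj_depth(2)[OF \<open>v \<noteq> r\<close>] by (simp add: w_def)
    \<comment> \<open>From depth \<open>N\<close> on the difference of \<open>f\<close> is small;
      nearer the root the ramp is at most \<open>N / M\<close>.\<close>
    have "cmod (f v - f w) * t v \<le> d"
    proof (cases "N \<le> tree_dist E r v")
      case True
      then show ?thesis using N[of v] t[of v] d unfolding w_def
        by (smt (verit) mult_left_le norm_ge_zero)
    next
      case False
      have "cmod (f v - f w) * t v \<le> L * (N / M)"
        using norm_diff_parent_le_lip_norm[OF f \<open>v \<noteq> r\<close>] False t L M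
        by (intro mult_mono) (auto simp: L_def w_def t_def divide_right_mono min.coboundedI2)
      also have "\<dots> \<le> d" using M by (simp add: field_simps)
      finally show ?thesis .
    qed
    \<comment> \<open>The ramp is constant from depth \<open>M\<close> on. Before that
      \<open>f w\<close> is at most \<open>C + d * M\<close> and the ramp gains
      \<open>1 / M\<close>, which gives \<open>C / M + d\<close>.\<close>
    moreover have "cmod (f w) * (t v - t w) \<le> 2 * d"
    proof (cases "tree_dist E r w \<ge> M")
      case True
      then have "t v = t w" using dv M by (simp add: t_def)
      then show ?thesis using d by simp
    next
      case False
      have "cmod (f w) * (t v - t w) \<le> (C + d * M) * (1 / M)"
      proof (rule mult_mono)
        show "cmod (f w) \<le> C + d * M"
          using C[of w] False d by (smt (verit) mult_left_mono of_nat_mono nat_le_linear)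
        have "t w = tree_dist E r w / M" using False M by (simp add: t_def)
        moreover have "t v \<le> tree_dist E r w / M + 1 / M"
          by (simp add: t_def dv add_divide_distrib min.coboundedI2)
        ultimately show "t v - t w \<le> 1 / M" by simp
      qed (use \<open>C \<ge> 0\<close> d dv M in \<open>auto simp: t_def min_def field_simps\<close>)
      also have "\<dots> \<le> 2 * d" using M by (simp add: field_simps)
      finally show ?thesis .
    qed
    moreover have "cmod (f v * of_real (t v) - f w * of_real (t w))
        \<le> cmod (f v - f w) * t v + cmod (f w) * (t v - t w)"
    proof -
      have "t w \<le> t v" unfolding t_def dv by (intro min.mono divide_right_mono) auto
      moreover have "f v * of_real (t v) - f w * of_real (t w)
          = (f v - f w) * of_real (t v) + f w * of_real (t v - t w)"
        by (simp add: algebra_simps)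
      ultimately show ?thesis using t[of v]
        by (metis abs_of_nonneg diff_ge_0_iff_ge norm_mult norm_of_real norm_triangle_ineq)
    qed
    ultimately show "cmod (f v * of_real (t v) - f (parent E r v) * of_real (t (parent E r v))) \<le> 3 * d"
      by (simp add: w_def)
  qed
  also have "3 * d < e" using \<open>e > 0\<close> by (simp add: d_def)
  finally have "lip_norm E r (\<lambda>v. f v - g v) < e" .
  moreover have "finite {v. g v \<noteq> 0}"
  proof (rule finite_subset[OF _ finite_depth[of M]])
    have "g v = 0" if "M < tree_dist E r v" for v
      using that M by (simp add: g_def t_def)
    then show "{v. g v \<noteq> 0} \<subseteq> {v. tree_dist E r v \<le> M}"
      by (auto simp: not_le[symmetric])
  qed
  ultimately show thesis using that by blast
qed

end

section \<open>Mixing\<close>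

text \<open>For \<open>f\<close> in \<open>U\<close> and \<open>h\<close> in \<open>V\<close>, both
  from \<open>X\<close>, the point \<open>f + G n\<close> stays in \<open>U\<close> for large
  \<open>n\<close>, and \<open>A ^^ n\<close> sends it to \<open>h + (A ^^ n) f\<close>, which lies
  in \<open>V\<close>. The preimages \<open>G n\<close> of \<open>h\<close> may be chosen separately
  for each \<open>n\<close>.\<close>

lemma kitai_criterion:
  assumes metric: "Metric_space S (\<lambda>f g. nrm (\<lambda>v. f v - g v))"
    and add: "\<And>f g. f \<in> S \<Longrightarrow> g \<in> S \<Longrightarrow> (\<lambda>v. f v + g v) \<in> S"
    and bounded: "bounded_operator_on S nrm A"
    and X: "X \<subseteq> S"
    and dense: "\<And>f e. f \<in> S \<Longrightarrow> e > 0 \<Longrightarrow> \<exists>g\<in>X. nrm (\<lambda>v. f v - g v) < e"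
    and null: "\<And>f. f \<in> X \<Longrightarrow> (\<lambda>n. nrm ((A ^^ n) f)) \<longlonglongrightarrow> 0"
    and right_inverse: "\<And>h. h \<in> X \<Longrightarrow>
      \<exists>G. (\<forall>n. G n \<in> S \<and> (A ^^ n) (G n) = h) \<and> (\<lambda>n. nrm (G n)) \<longlonglongrightarrow> 0"
  shows "mixing_on S nrm A"
  unfolding mixing_on_def
proof (intro conjI allI impI bounded)
  interpret Metric_space S "\<lambda>f g. nrm (\<lambda>v. f v - g v)" by (rule metric)
  have A_in: "(A ^^ n) f \<in> S" if "f \<in> S" for n f
    using that bounded by (induction n) (auto simp: bounded_operator_on_def)
  have A_add: "(A ^^ n) (\<lambda>v. f v + g v) = (\<lambda>v. (A ^^ n) f v + (A ^^ n) g v)"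
    if "f \<in> S" "g \<in> S" for n f g
    using that A_in bounded by (induction n) (auto simp: bounded_operator_on_def)
  have open_dense: "\<exists>f\<in>X. \<exists>e>0. \<forall>g\<in>S. nrm g < e \<longrightarrow> (\<lambda>v. f v + g v) \<in> U"
    if U: "openin (norm_topology S nrm) U" "U \<noteq> {}" for U
  proof -
    obtain u where "u \<in> U" using U by auto
    then obtain e where "e > 0" and e: "mball u e \<subseteq> U" and "u \<in> S"
      using U unfolding norm_topology_def openin_mtopology by blast
    then obtain f where f: "f \<in> X" "nrm (\<lambda>v. u v - f v) < e" using dense by blast
    have "f \<in> S" using f X by auto
    \<comment> \<open>The radius left after moving the centre of the ball from \<open>u\<close> to
      \<open>f\<close>.\<close>
    define e' where "e' = e - nrm (\<lambda>v. u v - f v)"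
    have "(\<lambda>v. f v + g v) \<in> U" if g: "g \<in> S" "nrm g < e'" for g
    proof -
      have fg: "(\<lambda>v. f v + g v) \<in> S" using add \<open>f \<in> S\<close> g by blast
      have "nrm (\<lambda>v. u v - (f v + g v))
          \<le> nrm (\<lambda>v. u v - f v) + nrm (\<lambda>v. f v - (f v + g v))"
        by (rule triangle) fact+
      also have "nrm (\<lambda>v. f v - (f v + g v)) = nrm (\<lambda>v. (f v + g v) - f v)"
        by (rule commute)
      also have "(\<lambda>v. (f v + g v) - f v) = g" by simp
      also have "nrm (\<lambda>v. u v - f v) + nrm g < e" using g by (simp add: e'_def)
      finally show ?thesis using e \<open>u \<in> S\<close> fg by auto
    qed
    moreover have "e' > 0" using f by (simp add: e'_def)
    ultimately show ?thesis using f by blast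
  qed
  fix U V
  assume UV: "openin (norm_topology S nrm) U \<and> U \<noteq> {} \<and> openin (norm_topology S nrm) V \<and> V \<noteq> {}"
  from UV open_dense[of U] obtain f a where f: "f \<in> X" "a > 0"
    and fU: "\<And>g. g \<in> S \<Longrightarrow> nrm g < a \<Longrightarrow> (\<lambda>v. f v + g v) \<in> U" by blast
  from UV open_dense[of V] obtain h b where h: "h \<in> X" "b > 0"
    and hV: "\<And>g. g \<in> S \<Longrightarrow> nrm g < b \<Longrightarrow> (\<lambda>v. h v + g v) \<in> V" by blast
  from right_inverse[OF \<open>h \<in> X\<close>] obtain G where G: "\<And>n. G n \<in> S" "\<And>n. (A ^^ n) (G n) = h"
    and G0: "(\<lambda>n. nrm (G n)) \<longlonglongrightarrow> 0" by blast
  have fS: "f \<in> S" using f X by auto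
  have "eventually (\<lambda>n. nrm (G n) < a \<and> nrm ((A ^^ n) f) < b) sequentially"
    using order_tendstoD(2)[OF G0 \<open>a > 0\<close>] order_tendstoD(2)[OF null[OF \<open>f \<in> X\<close>] \<open>b > 0\<close>]
    by eventually_elim simp
  then obtain N where N: "\<And>n. n \<ge> N \<Longrightarrow> nrm (G n) < a \<and> nrm ((A ^^ n) f) < b"
    by (auto simp: eventually_sequentially)
  have "(A ^^ n) ` U \<inter> V \<noteq> {}" if "n \<ge> N" for n
  proof -
    have "(\<lambda>v. f v + G n v) \<in> U" using fU G N that by blast
    moreover have "(A ^^ n) (\<lambda>v. f v + G n v) = (\<lambda>v. h v + (A ^^ n) f v)"
      using A_add[OF fS G(1)] G(2) by (simp add: add.commute)
    moreover have "(\<lambda>v. h v + (A ^^ n) f v) \<in> V" using hV A_in[OF fS] N that by blast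
    ultimately show ?thesis by (metis IntI empty_iff imageI)
  qed
  then show "\<exists>N\<^sub>0. \<forall>n\<ge>N\<^sub>0. (A ^^ n) ` U \<inter> V \<noteq> {}" by blast
qed

section \<open>Powers of the weighted composition operator and the minimal distance\<close>

lemma weighted_comp_op_funpow:
  "((\<lambda>f v. lam * comp_op \<phi> f v) ^^ n) f = (\<lambda>v. lam ^ n * f ((\<phi> ^^ n) v))"
  by (induction n) (simp_all add: comp_op_def funpow_swap1 fun_eq_iff)

lemma (in rooted_tree) bounded_operator_on_cmult:
  assumes "bounded_operator_on (little_lip_space E r) (lip_norm E r) A"
  shows "bounded_operator_on (little_lip_space E r) (lip_norm E r) (\<lambda>f v. a * A f v)"
proof -
  from assms obtain K where in_A: "\<And>f. f \<in> little_lip_space E r \<Longrightarrow> A f \<in> little_lip_space E r"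
    and K: "\<And>f. f \<in> little_lip_space E r \<Longrightarrow> lip_norm E r (A f) \<le> K * lip_norm E r f"
    unfolding bounded_operator_on_def by blast
  have "lip_norm E r (\<lambda>v. a * A f v) \<le> (cmod a * K) * lip_norm E r f"
    if "f \<in> little_lip_space E r" for f
    using order_trans[OF lip_norm_cmult_le[OF in_A[OF that]] mult_left_mono[OF K[OF that]]]
    by (simp add: mult.assoc)
  then show ?thesis
    using assms little_lip_space_cmult unfolding bounded_operator_on_def
    by (intro conjI exI[of _ "cmod a * K"]) (simp_all add: algebra_simps)
qed

lemma (in rooted_tree) min_dist_le: "u \<noteq> v \<Longrightarrow> min_dist E \<phi> n v \<le> tree_dist E ((\<phi> ^^ n) u) ((\<phi> ^^ n) v)"
  unfolding min_dist_def by (rule Least_le) blast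

text \<open>A second vertex exists, so the minimum is attained, and injectivity of the iterate keeps
  it from being 0. The tents divide by this number.\<close>

lemma (in rooted_tree) min_dist_pos:
  assumes "inj \<phi>"
  shows "min_dist E \<phi> n v > 0"
proof -
  obtain u0 where "u0 \<noteq> v"
    using infinite_vertices by (metis finite.simps UNIV_eq_I insertI1)
  then have "\<exists>k u. u \<noteq> v \<and> k = tree_dist E ((\<phi> ^^ n) u) ((\<phi> ^^ n) v)" by blast
  then have "\<exists>u. u \<noteq> v \<and> min_dist E \<phi> n v = tree_dist E ((\<phi> ^^ n) u) ((\<phi> ^^ n) v)"
    unfolding min_dist_def by (rule LeastI_ex)
  moreover have "inj (\<phi> ^^ n)" using assms by (rule inj_fn)
  ultimately show ?thesis by (metis gr0I tree_dist_eq_0_iff injD)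
qed

section \<open>Verification of the criterion\<close>

theorem theorem6p6:
  fixes E :: "'v \<Rightarrow> 'v \<Rightarrow> bool" and r :: 'v and \<phi> :: "'v \<Rightarrow> 'v" and lam :: complex
  assumes "rooted_tree E r"
    and "inj \<phi>"
    and "\<nexists>v. periodic_point \<phi> v"
    and "bounded_operator_on (little_lip_space E r) (lip_norm E r) (comp_op \<phi>)"
    and "cmod lam \<le> 1"
    and "\<forall>v. filterlim (\<lambda>n. cmod lam ^ n * real (min_dist E \<phi> n v)) at_top sequentially"
    and "\<exists>c\<ge>1. \<exists>N\<ge>1. \<forall>n\<ge>N. \<forall>v. tree_dist E r ((\<phi> ^^ n) v) + c \<ge> min_dist E \<phi> n v"
    and "cmod lam = 1 \<longrightarrow> (\<forall>v. finite {n. n \<ge> 1 \<and> (\<phi> ^^ n) -` {v} \<noteq> {}})"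
  shows "mixing_on (little_lip_space E r) (lip_norm E r) (\<lambda>f v. lam * comp_op \<phi> f v)"
proof -
  interpret rooted_tree E r by fact
  have lam0: "lam \<noteq> 0"
  proof
    assume "lam = 0"
    moreover have "eventually (\<lambda>n. cmod lam ^ n * real (min_dist E \<phi> n r) > 0) sequentially"
      using assms(6) by (auto simp: filterlim_at_top_dense)
    ultimately obtain M where "\<And>n. n \<ge> M \<Longrightarrow> (0::real) ^ n * real (min_dist E \<phi> n r) > 0"
      by (auto simp: eventually_sequentially)
    \<comment> \<open>The successor avoids the exponent 0, where \<open>0 ^ 0 = 1\<close>.\<close>
    from this[of "Suc M"] show False by simp
  qed
  show ?thesis
  proof (rule kitai_criterion[where X = "{f. finite {v. f v \<noteq> 0}}"])
    show "bounded_operator_on (little_lip_space E r) (lip_norm E r) (\<lambda>f v. lam * comp_op \<phi> f v)"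
      by (rule bounded_operator_on_cmult) fact
    show "\<exists>g\<in>{f. finite {v. f v \<noteq> 0}}. lip_norm E r (\<lambda>v. f v - g v) < e"
      if "f \<in> little_lip_space E r" "e > 0" for f e
      using finite_support_dense[OF that] by blast
  next
    fix f :: "'v \<Rightarrow> complex" assume "f \<in> {f. finite {v. f v \<noteq> 0}}"
    then have fin: "finite {v. f v \<noteq> 0}" by simp
    show "(\<lambda>n. lip_norm E r (((\<lambda>f v. lam * comp_op \<phi> f v) ^^ n) f)) \<longlonglongrightarrow> 0"
      unfolding weighted_comp_op_funpow
    proof (cases "cmod lam = 1")
      case True
      have "\<forall>\<^sub>F n in sequentially. (\<phi> ^^ n) -` {w} = {}" for w
      proof -
        have "finite {n. n \<ge> 1 \<and> (\<phi> ^^ n) -` {w} \<noteq> {}}" using assms(8) True by blast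
        then obtain M where "\<forall>n\<in>{n. n \<ge> 1 \<and> (\<phi> ^^ n) -` {w} \<noteq> {}}. n \<le> M"
          by (auto simp: finite_nat_set_iff_bounded_le)
        \<comment> \<open>\<open>Suc M\<close> puts \<open>n\<close> beyond the bound and also
          ensures \<open>n \<ge> 1\<close>, as the finite set concerns positive \<open>n\<close>
          only.\<close>
        then have "(\<phi> ^^ n) -` {w} = {}" if "Suc M \<le> n" for n
          using that by (metis (mono_tags, lifting) Suc_le_D le_simps(3) mem_Collect_eq not_less_eq_eq le_add1 plus_1_eq_Suc)
        then show ?thesis by (rule eventually_sequentiallyI)
      qed
      then have "\<forall>\<^sub>F n in sequentially. \<forall>w\<in>{v. f v \<noteq> 0}. (\<phi> ^^ n) -` {w} = {}"
        using fin by (intro eventually_ball_finite) auto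
      then have "\<forall>\<^sub>F n in sequentially. lip_norm E r (\<lambda>v. lam ^ n * f ((\<phi> ^^ n) v)) = 0"
      proof eventually_elim
        case (elim n)
        then have "f ((\<phi> ^^ n) v) = 0" for v by blast
        then show ?case
          using lip_norm_eq_0_iff[of "\<lambda>_. 0"] finite_support_little_lip[of "\<lambda>_. 0"] by simp
      qed
      then show "(\<lambda>n. lip_norm E r (\<lambda>v. lam ^ n * f ((\<phi> ^^ n) v))) \<longlonglongrightarrow> 0"
        by (rule tendsto_eventually)
    next
      case False
      with assms(5) have "cmod lam < 1" by simp
      \<comment> \<open>A crude bound for all values of \<open>f\<close>; differences along edges
        then cost \<open>2 * B\<close>.\<close>
      define B where "B = (\<Sum>v | f v \<noteq> 0. cmod (f v))"
      have B: "cmod (f v) \<le> B" for v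
        using fin member_le_sum[of v "{v. f v \<noteq> 0}" "\<lambda>v. cmod (f v)"]
        by (cases "f v = 0") (auto simp: B_def sum_nonneg)
      have B': "cmod (lam ^ n * f v) \<le> cmod lam ^ n * B" for n v
        using B[of v] by (simp add: norm_mult norm_power mult_left_mono)
      have le: "lip_norm E r (\<lambda>v. lam ^ n * f ((\<phi> ^^ n) v)) \<le> cmod lam ^ n * (2 * B)" for n
      proof (rule lip_norm_leI)
        have "0 \<le> cmod lam ^ n * B" using norm_ge_zero B' by (rule order_trans)
        then show "cmod (lam ^ n * f ((\<phi> ^^ n) r)) \<le> cmod lam ^ n * (2 * B)"
          using B'[of n "(\<phi> ^^ n) r"] by simp
        show "cmod (lam ^ n * f ((\<phi> ^^ n) v) - lam ^ n * f ((\<phi> ^^ n) (parent E r v)))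
            \<le> cmod lam ^ n * (2 * B)" for v
          by (rule order_trans[OF norm_triangle_ineq4 order_trans[OF add_mono[OF B' B']]]) simp
      qed
      have lim: "(\<lambda>n. cmod lam ^ n * (2 * B)) \<longlonglongrightarrow> 0"
        using \<open>cmod lam < 1\<close> by (intro tendsto_mult_left_zero LIMSEQ_power_zero) simp
      show "(\<lambda>n. lip_norm E r (\<lambda>v. lam ^ n * f ((\<phi> ^^ n) v))) \<longlonglongrightarrow> 0"
        by (rule tendsto_sandwich[OF _ _ tendsto_const lim]) (simp_all add: le lip_norm_nonneg)
    qed
  next
    fix h :: "'v \<Rightarrow> complex" assume "h \<in> {f. finite {v. f v \<noteq> 0}}"
    then have fin: "finite {v. h v \<noteq> 0}" by simp
    obtain c N where c: "c \<ge> 1"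
      and cN: "\<And>n v. n \<ge> N \<Longrightarrow> min_dist E \<phi> n v \<le> tree_dist E r ((\<phi> ^^ n) v) + c"
      using assms(7) by auto
    define m where "m n w = real (min_dist E \<phi> n w)" for n w
    have m: "m n w > 0" for n w using min_dist_pos[OF assms(2)] by (simp add: m_def)
    define b where "b n w x = max 0 (1 - tree_dist E x ((\<phi> ^^ n) w) / m n w)" for n w x
    \<comment> \<open>By minimality of \<open>m n w\<close>, every \<open>\<phi> ^^ n\<close> image
      of a vertex other than \<open>w\<close> is at least that far from the peak, where the tent is
      0. Hence the tent composed with \<open>\<phi> ^^ n\<close> is the indicator of
      \<open>w\<close>.\<close>
    have b_iter: "b n w ((\<phi> ^^ n) v) = of_bool (w = v)" for n w v
      using m[of n w] min_dist_le[of v w \<phi> n] by (auto simp: b_def m_def)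
    have b_fin: "finite {x. b n w x \<noteq> 0}" for n w
    proof (rule finite_subset[OF _ finite_ball])
      show "{x. b n w x \<noteq> 0} \<subseteq> {x. tree_dist E x ((\<phi> ^^ n) w) \<le> min_dist E \<phi> n w}"
        using m[of n w] by (auto simp: b_def m_def max_def field_simps split: if_splits)
    qed
    \<comment> \<open>Dividing hypothesis (2) by \<open>m n w\<close> bounds
      \<open>1 - d / m\<close> at the root, \<open>d\<close> being the depth of the peak.\<close>
    have b_root: "\<bar>b n w r\<bar> \<le> c / m n w" if "n \<ge> N" for n w
    proof -
      have "m n w \<le> tree_dist E r ((\<phi> ^^ n) w) + c"
        using cN[OF that, of w] unfolding m_def of_nat_add[symmetric] of_nat_le_iff .
      then have "1 \<le> tree_dist E r ((\<phi> ^^ n) w) / m n w + c / m n w"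
        using m[of n w] by (simp flip: add_divide_distrib)
      moreover have "0 \<le> c / m n w" using m[of n w] by simp
      ultimately show ?thesis unfolding b_def by linarith
    qed
    \<comment> \<open>Truncation at 0 does not enlarge differences, so the slope is at most
      \<open>1 / m n w\<close>; as \<open>c \<ge> 1\<close>, the bound at the root serves here
      too.\<close>
    have b_diff: "\<bar>b n w v - b n w (parent E r v)\<bar> \<le> c / m n w" if "v \<noteq> r" for n w v
    proof -
      define x y where "x = tree_dist E v ((\<phi> ^^ n) w)" and "y = tree_dist E (parent E r v) ((\<phi> ^^ n) w)"
      have "\<bar>real x - real y\<bar> \<le> 1"
        using parent_adj_depth(1)[OF that] sym tree_dist_adj[of v "parent E r v" "(\<phi> ^^ n) w"]
          tree_dist_adj[of "parent E r v" v "(\<phi> ^^ n) w"] by (auto simp: x_def y_def)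
      have "\<bar>b n w v - b n w (parent E r v)\<bar> \<le> \<bar>x / m n w - y / m n w\<bar>"
        unfolding b_def x_def[symmetric] y_def[symmetric] by linarith
      also have "\<dots> = \<bar>real x - real y\<bar> / m n w"
        using m[of n w] by (simp flip: diff_divide_distrib)
      also have "\<dots> \<le> c / m n w"
        using \<open>\<bar>real x - real y\<bar> \<le> 1\<close> c m[of n w] by (intro divide_right_mono) auto
      finally show ?thesis .
    qed
    \<comment> \<open>\<open>h\<close> is a finite combination of indicators, and each indicator is
      replaced by its tent preimage.\<close>
    define G where "G n x = (\<Sum>w | h w \<noteq> 0. h w / lam ^ n * of_real (b n w x))" for n x
    define B where "B n = (\<Sum>w | h w \<noteq> 0. cmod (h w) * c * inverse (cmod lam ^ n * m n w))" for n
    \<comment> \<open>The free \<open>z\<close> stands both for the tent values at the root and for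
      their differences along an edge.\<close>
    have sum_le: "cmod (\<Sum>w | h w \<noteq> 0. h w / lam ^ n * of_real (z w)) \<le> B n"
      if "\<And>w. \<bar>z w\<bar> \<le> c / m n w" for z n
    proof -
      have "cmod (h w / lam ^ n * of_real (z w)) \<le> cmod (h w) * c * inverse (cmod lam ^ n * m n w)" for w
      proof -
        have "cmod (h w / lam ^ n * of_real (z w)) = cmod (h w) / cmod lam ^ n * \<bar>z w\<bar>"
          by (simp add: norm_mult norm_divide norm_power)
        also have "\<dots> \<le> cmod (h w) / cmod lam ^ n * (c / m n w)"
          using that by (intro mult_left_mono) auto
        also have "\<dots> = cmod (h w) * c * inverse (cmod lam ^ n * m n w)"
          by (simp add: divide_inverse)
        finally show ?thesis .
      qed
      then show ?thesis unfolding B_def by (intro sum_norm_le)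
    qed
    have "G n \<in> little_lip_space E r" for n
    proof (rule finite_support_little_lip, rule finite_subset)
      show "{x. G n x \<noteq> 0} \<subseteq> (\<Union>w\<in>{w. h w \<noteq> 0}. {x. b n w x \<noteq> 0})"
        unfolding G_def by (auto elim!: sum.not_neutral_contains_not_neutral)
    qed (use fin b_fin in blast)
    moreover have "lam ^ n * G n ((\<phi> ^^ n) v) = h v" for n v
    proof -
      \<comment> \<open>Only the tent belonging to \<open>v\<close> survives; outside the support of
        \<open>h\<close> the sum is 0, which is again \<open>h v\<close>.\<close>
      have "lam ^ n * G n ((\<phi> ^^ n) v) = (\<Sum>w | h w \<noteq> 0. if w = v then h v else 0)"
        unfolding G_def sum_distrib_left using lam0 by (intro sum.cong) (auto simp: b_iter)
      also have "\<dots> = h v" using fin by simp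
      finally show ?thesis .
    qed
    moreover have "(\<lambda>n. lip_norm E r (G n)) \<longlonglongrightarrow> 0"
    proof (rule tendsto_sandwich[OF _ _ tendsto_const])
      have "lip_norm E r (G n) \<le> B n" if "n \<ge> N" for n
      proof (rule lip_norm_leI)
        show "cmod (G n r) \<le> B n"
          unfolding G_def by (rule sum_le) (rule b_root[OF that])
        fix v assume "v \<noteq> r"
        have "G n v - G n (parent E r v) =
            (\<Sum>w | h w \<noteq> 0. h w / lam ^ n * of_real (b n w v - b n w (parent E r v)))"
          unfolding G_def by (simp add: sum_subtractf right_diff_distrib)
        then show "cmod (G n v - G n (parent E r v)) \<le> B n"
          using sum_le[OF b_diff[OF \<open>v \<noteq> r\<close>]] by simp
      qed
      then show "\<forall>\<^sub>F n in sequentially. lip_norm E r (G n) \<le> B n"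
        by (rule eventually_sequentiallyI)
      \<comment> \<open>Hypothesis (1) is pointwise in \<open>w\<close>, which suffices since
        \<open>B n\<close> sums over the finite support of \<open>h\<close>.\<close>
      have "(\<lambda>n. inverse (cmod lam ^ n * m n w)) \<longlonglongrightarrow> 0" for w
        using assms(6) unfolding m_def by (intro tendsto_inverse_0_at_top) blast
      then show "B \<longlonglongrightarrow> 0"
        unfolding B_def by (intro tendsto_null_sum tendsto_mult_right_zero)
    qed (simp add: lip_norm_nonneg)
    ultimately show "\<exists>G. (\<forall>n. G n \<in> little_lip_space E r \<and> ((\<lambda>f v. lam * comp_op \<phi> f v) ^^ n) (G n) = h) \<and>
        (\<lambda>n. lip_norm E r (G n)) \<longlonglongrightarrow> 0"
      unfolding weighted_comp_op_funpow by (intro exI[of _ G]) auto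
  qed (use Metric_space_little_lip little_lip_space_add finite_support_little_lip in auto)
qed

end
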